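(* For primes $p\ge5$ let $S_p$ range over the Beauville surfaces with group $G_p:=(\mathbb{Z}/p\mathbb{Z})^2$ admitting a ramification structure of type $(\tau_p,\tau_p)$, where $\tau_p=(p,p,p)$. If $h(G_p;\tau_p,\tau_p)$ denotes the number of Beauville surfaces admitting these data, then, as $p\to\infty$, $$h(G_p;\tau_p,\tau_p)=\Theta\bigl(\chi(S_p)^{2}\bigr).$$
   Context: Asymptotic notation: $f(p)=\Theta(g(p))$ means that there are constants $c_1,c_2>0$ (independent of $p$) with $c_1g(p)\le f(p)\le c_2g(p)$ as $p\to\infty$. Surfaces. A Beauville surface (of unmixed type) is a complex surface $S=(C_1\times C_2)/G$ with $C_1,C_2$ curves of genus at least $2$ and $G$ a finite group acting freely and diagonally on $C_1\times C_2$, with no nontrivial element acting trivially on one of the factors, such that $C_i/G\cong\mathbb{P}^1$ and $C_i\to C_i/G$ is ramified over exactly $3$ points, $i=1,2$. Only unmixed surfaces are considered. Beauville surfaces are rigid, so each gives an isolated point (a connected component) of the moduli space; $h$ counts these points. Group-theoretic data. A spherical $3$-system of generators of a finite group $G$ is $T=(x_1,x_2,x_3)\in G^3$ with $\langle x_1,x_2,x_3\rangle=G$ and $x_1x_2x_3=1$. It has type $(m_1,m_2,m_3)$ if $\mathrm{ord}(x_i)=m_i$. Put $\Sigma(T)=\bigcup_{g\in G}\bigcup_{j\ge0}\bigcup_{k} g x_k^{j}g^{-1}$; $T_1,T_2$ are disjoint if $\Sigma(T_1)\cap\Sigma(T_2)=\{1\}$. Beauville surfaces with group $G$ and types $(\tau_1,\tau_2)$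 correspond to pairs of disjoint spherical $3$-systems of generators of $G$ of types $\tau_1,\tau_2$ (an unmixed ramification structure of type $(\tau_1,\tau_2)$). For $\tau_1=\tau_2=(m_1,m_2,m_3)$, $\chi(S)=1+p_g-q$ satisfies $4\chi(S)=|G|\bigl(1-\tfrac1{m_1}-\tfrac1{m_2}-\tfrac1{m_3}\bigr)^2$. For $\tau=(m,m,m)$, $h(G;\tau,\tau)$ equals (by Bauer-Catanese) the number of orbits on the set $\mathcal{U}(G;\tau,\tau)$ of pairs $(T_1,T_2)$ of disjoint spherical $3$-systems of generators of type $\tau$ under $(\mathbf{B}_3\wr\mathbb{Z}/2\mathbb{Z})\times\mathrm{Aut}(G)$, where $\mathbf{B}_3=\langle\sigma_1,\sigma_2\rangle$ acts on each of $T_1,T_2$ independently by $\sigma_1:(x_1,x_2,x_3)\mapsto(x_1x_2x_1^{-1},x_1,x_3)$, $\sigma_2:(x_1,x_2,x_3)\mapsto(x_1,x_2x_3x_2^{-1},x_2)$, $\mathbb{Z}/2\mathbb{Z}$ exchanges $T_1$ and $T_2$, and $\mathrm{Aut}(G)$ acts simultaneously on $T_1$ and $T_2$. *)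

theory Defs
  imports "HOL-Algebra.Group_Action" "HOL-Algebra.Elementary_Groups"
    "HOL-Algebra.Multiplicative_Group" "HOL-Number_Theory.Cong" "HOL-Library.Landau_Symbols"
begin

section \<open>Spherical 3-systems of generators and unmixed ramification structures\<close>

type_synonym 'a triple = "'a \<times> 'a \<times> 'a"

definition spherical_systems :: "('a, 'b) monoid_scheme \<Rightarrow> 'a triple set" where
  "spherical_systems G = {(x1, x2, x3).
     x1 \<in> carrier G \<and> x2 \<in> carrier G \<and> x3 \<in> carrier G \<and>
     generate G {x1, x2, x3} = carrier G \<and>
     x1 \<otimes>\<^bsub>G\<^esub> x2 \<otimes>\<^bsub>G\<^esub> x3 = \<one>\<^bsub>G\<^esub>}"

definition system_type :: "('a, 'b) monoid_scheme \<Rightarrow> 'a triple \<Rightarrow> nat triple" where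
  "system_type G = (\<lambda>(x1, x2, x3). (group.ord G x1, group.ord G x2, group.ord G x3))"

definition Sigma_set :: "('a, 'b) monoid_scheme \<Rightarrow> 'a triple \<Rightarrow> 'a set" where
  "Sigma_set G = (\<lambda>(x1, x2, x3).
     {g \<otimes>\<^bsub>G\<^esub> (x [^]\<^bsub>G\<^esub> j) \<otimes>\<^bsub>G\<^esub> inv\<^bsub>G\<^esub> g | g x (j :: nat).
        g \<in> carrier G \<and> x \<in> {x1, x2, x3}})"

definition disjoint_systems :: "('a, 'b) monoid_scheme \<Rightarrow> 'a triple \<Rightarrow> 'a triple \<Rightarrow> bool" where
  "disjoint_systems G T1 T2 \<longleftrightarrow> Sigma_set G T1 \<inter> Sigma_set G T2 = {\<one>\<^bsub>G\<^esub>}"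

text \<open>
  The set \<open>\<U>(G; \<tau>\<^sub>1, \<tau>\<^sub>2)\<close>. Its elements are the algebraic data of the Beauville surfaces
  \<open>(C\<^sub>1 \<times> C\<^sub>2)/G\<close> of unmixed type.
\<close>

definition ramification_structures ::
    "('a, 'b) monoid_scheme \<Rightarrow> nat triple \<Rightarrow> nat triple \<Rightarrow> ('a triple \<times> 'a triple) set" where
  "ramification_structures G \<tau>1 \<tau>2 = {(T1, T2).
     T1 \<in> spherical_systems G \<and> T2 \<in> spherical_systems G \<and>
     system_type G T1 = \<tau>1 \<and> system_type G T2 = \<tau>2 \<and> disjoint_systems G T1 T2}"


section \<open>The invariant \<open>\<chi>\<close>\<close>

text \<open>
  Since \<open>G\<close> acts freely, \<open>\<chi>(S) = (g(C\<^sub>1) - 1) (g(C\<^sub>2) - 1) / |G|\<close>, and by Riemann-Hurwitz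
  \<open>2 (g(C\<^sub>i) - 1) = |G| (1 - 1/m\<^sub>1 - 1/m\<^sub>2 - 1/m\<^sub>3)\<close>, where \<open>(m\<^sub>1, m\<^sub>2, m\<^sub>3)\<close> is the type
  of \<open>T\<^sub>i\<close>.
\<close>

definition orbifold_factor :: "nat triple \<Rightarrow> real" where
  "orbifold_factor = (\<lambda>(m1, m2, m3). 1 - 1 / real m1 - 1 / real m2 - 1 / real m3)"

definition surface_chi :: "('a, 'b) monoid_scheme \<Rightarrow> 'a triple \<times> 'a triple \<Rightarrow> real" where
  "surface_chi G = (\<lambda>(T1, T2).
     real (order G) * orbifold_factor (system_type G T1) * orbifold_factor (system_type G T2) / 4)"


section \<open>The number of Beauville surfaces\<close>

definition braid1 :: "('a, 'b) monoid_scheme \<Rightarrow> 'a triple \<Rightarrow> 'a triple" where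
  "braid1 G = (\<lambda>(x1, x2, x3). (x1 \<otimes>\<^bsub>G\<^esub> x2 \<otimes>\<^bsub>G\<^esub> inv\<^bsub>G\<^esub> x1, x1, x3))"

definition braid2 :: "('a, 'b) monoid_scheme \<Rightarrow> 'a triple \<Rightarrow> 'a triple" where
  "braid2 G = (\<lambda>(x1, x2, x3). (x1, x2 \<otimes>\<^bsub>G\<^esub> x3 \<otimes>\<^bsub>G\<^esub> inv\<^bsub>G\<^esub> x2, x2))"

definition apply_triple :: "('a \<Rightarrow> 'a) \<Rightarrow> 'a triple \<Rightarrow> 'a triple" where
  "apply_triple \<alpha> = map_prod \<alpha> (map_prod \<alpha> \<alpha>)"

text \<open>
  The maps by which the generators of \<open>(\<^bold>B\<^sub>3 \<wr> \<int>/2\<int>) \<times> Aut(G)\<close> act on pairs of triples: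
  the braid generators on either entry, the exchange of the entries, and the simultaneous
  action of the automorphisms.
\<close>

definition moduli_moves ::
    "('a, 'b) monoid_scheme \<Rightarrow> ('a triple \<times> 'a triple \<Rightarrow> 'a triple \<times> 'a triple) set" where
  "moduli_moves G =
     {map_prod \<sigma> id | \<sigma>. \<sigma> \<in> {braid1 G, braid2 G}} \<union>
     {map_prod id \<sigma> | \<sigma>. \<sigma> \<in> {braid1 G, braid2 G}} \<union>
     {prod.swap} \<union>
     {map_prod (apply_triple \<alpha>) (apply_triple \<alpha>) | \<alpha>. \<alpha> \<in> auto G}"

text \<open>
  The orbits depend only on the image of \<open>(\<^bold>B\<^sub>3 \<wr> \<int>/2\<int>) \<times> Aut(G)\<close> in the symmetric group
  of \<open>\<U>(G; \<tau>, \<tau>)\<close>, which is the subgroup generated by the images of the generators. The type is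
  \<open>\<tau> = (m, m, m)\<close> because the braid group permutes the entries of a type; the lemma
  \<open>moduli_moves_Bij\<close> below shows that the moves do permute \<open>\<U>(G; \<tau>, \<tau>)\<close> in this case.
\<close>

definition moduli_group ::
    "('a, 'b) monoid_scheme \<Rightarrow> nat \<Rightarrow>
     ('a triple \<times> 'a triple \<Rightarrow> 'a triple \<times> 'a triple) monoid" where
  "moduli_group G m = (let U = ramification_structures G (m, m, m) (m, m, m) in
     (BijGroup U)\<lparr>carrier := generate (BijGroup U) ((\<lambda>f. restrict f U) ` moduli_moves G)\<rparr>)"

text \<open>\<open>h(G; \<tau>, \<tau>)\<close> for \<open>\<tau> = (m, m, m)\<close>.\<close>

definition beauville_count :: "('a, 'b) monoid_scheme \<Rightarrow> nat \<Rightarrow> nat" where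
  "beauville_count G m =
     card (orbits (moduli_group G m) (ramification_structures G (m, m, m) (m, m, m)) (\<lambda>f. f))"


section \<open>The group \<open>(\<int>/p\<int>)\<^sup>2\<close>\<close>

definition Zmod_square :: "nat \<Rightarrow> (int \<times> int) monoid" where
  "Zmod_square p = integer_mod_group p \<times>\<times> integer_mod_group p"


section \<open>Well-definedness\<close>

context group
begin

lemma conj_pow:
  assumes "g \<in> carrier G" "x \<in> carrier G"
  shows "(g \<otimes> x \<otimes> inv g) [^] (n::nat) = g \<otimes> (x [^] n) \<otimes> inv g"
proof (induction n)
  case (Suc n)
  have "(g \<otimes> x \<otimes> inv g) [^] Suc n = (g \<otimes> x [^] n \<otimes> inv g) \<otimes> (g \<otimes> x \<otimes> inv g)"
    using Suc by simp
  also have "\<dots> = g \<otimes> x [^] n \<otimes> (inv g \<otimes> g) \<otimes> x \<otimes> inv g"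
    using assms by (simp only: m_assoc m_closed inv_closed nat_pow_closed)
  also have "\<dots> = g \<otimes> (x [^] Suc n) \<otimes> inv g"
    using assms by (simp add: m_assoc)
  finally show ?case .
qed (use assms in simp)

lemma ord_conj:
  assumes "g \<in> carrier G" "x \<in> carrier G"
  shows "ord (g \<otimes> x \<otimes> inv g) = ord x"
proof -
  have "(g \<otimes> y \<otimes> inv g = \<one>) = (y = \<one>)" if "y \<in> carrier G" for y
    using assms(1) that
    by (metis inv_solve_right l_cancel_one l_one m_closed one_closed r_cancel_one r_one)
  then show ?thesis
    using assms by (subst ord_unique) (auto simp: conj_pow pow_eq_id)
qed

lemma Sigma_set_braid:
  assumes "T \<in> spherical_systems G" "f \<in> {braid1 G, braid2 G}"
  shows "Sigma_set G (f T) = Sigma_set G T"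
proof -
  define C where "C x = {g \<otimes> (x [^] j) \<otimes> inv g | g (j::nat). g \<in> carrier G}" for x
  have S: "Sigma_set G (x, y, z) = C x \<union> C y \<union> C z" for x y z
    by (auto simp: Sigma_set_def C_def)
  have conj: "C (a \<otimes> x \<otimes> inv a) = C x" if ax: "a \<in> carrier G" "x \<in> carrier G" for a x
  proof -
    have sub: "C (b \<otimes> y \<otimes> inv b) \<subseteq> C y" if "b \<in> carrier G" "y \<in> carrier G" for b y
    proof
      fix w assume "w \<in> C (b \<otimes> y \<otimes> inv b)"
      then obtain g and j :: nat where g: "g \<in> carrier G"
        and w: "w = g \<otimes> ((b \<otimes> y \<otimes> inv b) [^] j) \<otimes> inv g"
        by (auto simp: C_def)
      have "w = (g \<otimes> b) \<otimes> (y [^] j) \<otimes> inv (g \<otimes> b)"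
        unfolding w conj_pow[OF that] using g that by (simp add: inv_mult_group m_assoc)
      with g that show "w \<in> C y" unfolding C_def by blast
    qed
    have "inv a \<otimes> (a \<otimes> x \<otimes> inv a) \<otimes> inv (inv a) = (inv a \<otimes> a) \<otimes> x \<otimes> (inv a \<otimes> a)"
      using ax by (simp only: m_assoc m_closed inv_closed inv_inv)
    then have "inv a \<otimes> (a \<otimes> x \<otimes> inv a) \<otimes> inv (inv a) = x"
      using ax by simp
    then show ?thesis
      using sub[of a x] sub[of "inv a" "a \<otimes> x \<otimes> inv a"] ax by auto
  qed
  show ?thesis
    using assms by (cases T) (auto simp: spherical_systems_def braid1_def braid2_def S conj)
qed

lemma spherical_braid:
  assumes T: "T \<in> spherical_systems G" and f: "f \<in> {braid1 G, braid2 G}"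
  shows "f T \<in> spherical_systems G"
proof -
  obtain x y z where [simp]: "T = (x, y, z)" by (cases T)
  have c[simp]: "x \<in> carrier G" "y \<in> carrier G" "z \<in> carrier G"
    and gen: "generate G {x, y, z} = carrier G" and prod: "x \<otimes> y \<otimes> z = \<one>"
    using T by (auto simp: spherical_systems_def)
  have full: "generate G H = carrier G"
    if "H \<subseteq> carrier G" "{x, y, z} \<subseteq> generate G H" for H
    using generate_subgroup_incl[OF that(2) generate_is_subgroup[OF that(1)]]
      generate_incl[OF that(1)] gen by auto
  have rec: "b \<in> generate G {a \<otimes> b \<otimes> inv a, a, d}" "b \<in> generate G {d, a \<otimes> b \<otimes> inv a, a}"
    if c': "a \<in> carrier G" "b \<in> carrier G" for a b d
  proof -
    have "inv a \<otimes> (a \<otimes> b \<otimes> inv a) \<otimes> a = (inv a \<otimes> a) \<otimes> b \<otimes> (inv a \<otimes> a)"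
      using c' by (simp only: m_assoc m_closed inv_closed)
    then have e: "inv a \<otimes> (a \<otimes> b \<otimes> inv a) \<otimes> a = b"
      using c' by simp
    have "inv a \<otimes> (a \<otimes> b \<otimes> inv a) \<otimes> a \<in> generate G {a \<otimes> b \<otimes> inv a, a, d}"
      "inv a \<otimes> (a \<otimes> b \<otimes> inv a) \<otimes> a \<in> generate G {d, a \<otimes> b \<otimes> inv a, a}"
      by (intro generate.eng generate.incl generate.inv; simp)+
    then show "b \<in> generate G {a \<otimes> b \<otimes> inv a, a, d}" "b \<in> generate G {d, a \<otimes> b \<otimes> inv a, a}"
      using e by simp_all
  qed
  have "generate G {x \<otimes> y \<otimes> inv x, x, z} = carrier G"
    using rec(1)[of x y z] by (intro full) (auto intro: generate.incl)
  moreover have "generate G {x, y \<otimes> z \<otimes> inv y, y} = carrier G"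
    using rec(2)[of y z x] by (intro full) (auto intro: generate.incl)
  moreover have "x \<otimes> y \<otimes> inv x \<otimes> x \<otimes> z = \<one>" "x \<otimes> (y \<otimes> z \<otimes> inv y) \<otimes> y = \<one>"
    using prod by (simp_all add: m_assoc)
  moreover have "x \<otimes> y \<otimes> inv x \<in> carrier G" "y \<otimes> z \<otimes> inv y \<in> carrier G"
    by simp_all
  ultimately have "braid1 G T \<in> spherical_systems G" "braid2 G T \<in> spherical_systems G"
    unfolding spherical_systems_def braid1_def braid2_def \<open>T = (x, y, z)\<close> prod.case mem_Collect_eq
    using c by blast+
  then show ?thesis using f by blast
qed

lemma type_braid:
  assumes T: "T \<in> spherical_systems G" and f: "f \<in> {braid1 G, braid2 G}"
    and ty: "system_type G T = (m, m, m)"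
  shows "system_type G (f T) = (m, m, m)"
proof -
  obtain x y z where [simp]: "T = (x, y, z)" by (cases T)
  have "x \<in> carrier G" "y \<in> carrier G" "z \<in> carrier G"
    using T by (simp_all add: spherical_systems_def)
  moreover have "ord x = m" "ord y = m" "ord z = m"
    using ty by (simp_all add: system_type_def)
  moreover have "f = braid1 G \<or> f = braid2 G"
    using f by simp
  ultimately show ?thesis
    by (elim disjE) (simp_all add: system_type_def braid1_def braid2_def ord_conj)
qed

lemma inj_braid:
  assumes f: "f \<in> {braid1 G, braid2 G}"
  shows "inj_on f (spherical_systems G)"
proof (rule inj_onI)
  fix T T'
  assume TT: "T \<in> spherical_systems G" "T' \<in> spherical_systems G" and eq: "f T = f T'"
  obtain x y z x' y' z' where [simp]: "T = (x, y, z)" "T' = (x', y', z')"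
    by (cases T, cases T')
  have c: "x \<in> carrier G" "y \<in> carrier G" "z \<in> carrier G"
    "x' \<in> carrier G" "y' \<in> carrier G" "z' \<in> carrier G"
    using TT by (simp_all add: spherical_systems_def)
  consider "f = braid1 G" | "f = braid2 G" using f by blast
  then show "T = T'"
  proof cases
    case 1
    have e: "x \<otimes> y \<otimes> inv x = x' \<otimes> y' \<otimes> inv x'" "x = x'" "z = z'"
      using eq unfolding 1 braid1_def \<open>T = (x, y, z)\<close> \<open>T' = (x', y', z')\<close> prod.case prod.inject
      by blast+
    then have "y = y'" using c by (metis Units_eq Units_l_cancel inv_closed m_closed right_cancel)
    then show ?thesis using e by simp
  next
    case 2
    have e: "y \<otimes> z \<otimes> inv y = y' \<otimes> z' \<otimes> inv y'" "y = y'" "x = x'"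
      using eq unfolding 2 braid2_def \<open>T = (x, y, z)\<close> \<open>T' = (x', y', z')\<close> prod.case prod.inject
      by blast+
    then have "z = z'" using c by (metis Units_eq Units_l_cancel inv_closed m_closed right_cancel)
    then show ?thesis using e by simp
  qed
qed

lemma apply_auto:
  assumes T: "T \<in> spherical_systems G" and \<alpha>: "\<alpha> \<in> auto G"
  shows "apply_triple \<alpha> T \<in> spherical_systems G"
    and "system_type G (apply_triple \<alpha> T) = system_type G T"
    and "Sigma_set G (apply_triple \<alpha> T) = \<alpha> ` Sigma_set G T"
proof -
  interpret a: group_hom G G \<alpha>
    using \<alpha> by unfold_locales (auto simp: auto_def)
  obtain x y z where [simp]: "T = (x, y, z)" by (cases T)
  have c[simp]: "x \<in> carrier G" "y \<in> carrier G" "z \<in> carrier G"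
    and gen: "generate G {x, y, z} = carrier G" and prod: "x \<otimes> y \<otimes> z = \<one>"
    using T by (auto simp: spherical_systems_def)
  have inj: "inj_on \<alpha> (carrier G)" and im: "\<alpha> ` carrier G = carrier G"
    using \<alpha> by (auto simp: auto_def Bij_def bij_betw_def)
  have "generate G (\<alpha> ` {x, y, z}) = carrier G"
    using a.generate_img[of "{x, y, z}"] gen im by simp
  moreover have "\<alpha> x \<otimes> \<alpha> y \<otimes> \<alpha> z = \<one>"
    using prod by (metis a.hom_mult a.hom_one c m_closed)
  ultimately show "apply_triple \<alpha> T \<in> spherical_systems G"
    by (simp add: spherical_systems_def apply_triple_def)
  have "(\<alpha> w [^] (n::nat) = \<one>) = (w [^] n = \<one>)" if "w \<in> carrier G" for w n
    using that inj by (metis a.hom_nat_pow a.hom_one inj_onD nat_pow_closed one_closed)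
  then have "ord (\<alpha> w) = ord w" if "w \<in> carrier G" for w
    using that by (subst ord_unique) (auto simp: pow_eq_id)
  then show "system_type G (apply_triple \<alpha> T) = system_type G T"
    by (simp add: system_type_def apply_triple_def)
  have im_conj: "\<alpha> (g \<otimes> w [^] (j::nat) \<otimes> inv g) = \<alpha> g \<otimes> \<alpha> w [^] j \<otimes> inv (\<alpha> g)"
    if "g \<in> carrier G" "w \<in> carrier G" for g w j
    using that by (simp add: a.hom_nat_pow)
  show "Sigma_set G (apply_triple \<alpha> T) = \<alpha> ` Sigma_set G T"
  proof (intro equalityI subsetI)
    fix v assume "v \<in> Sigma_set G (apply_triple \<alpha> T)"
    then obtain g w and j :: nat where "g \<in> carrier G" "w \<in> {x, y, z}"
      and v: "v = g \<otimes> \<alpha> w [^] j \<otimes> inv g"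
      by (auto simp: Sigma_set_def apply_triple_def)
    moreover obtain g' where "g' \<in> carrier G" "\<alpha> g' = g"
      using im \<open>g \<in> carrier G\<close> by (metis image_iff)
    ultimately have "v = \<alpha> (g' \<otimes> w [^] j \<otimes> inv g')" "g' \<in> carrier G" "w \<in> {x, y, z}"
      using im_conj by auto
    then show "v \<in> \<alpha> ` Sigma_set G T"
      unfolding Sigma_set_def \<open>T = (x, y, z)\<close> by blast
  next
    fix v assume "v \<in> \<alpha> ` Sigma_set G T"
    then obtain g w and j :: nat where gw: "g \<in> carrier G" "w \<in> {x, y, z}"
      and v: "v = \<alpha> (g \<otimes> w [^] j \<otimes> inv g)"
      by (auto simp: Sigma_set_def)
    have w: "w \<in> carrier G" using gw by auto
    have "v = \<alpha> g \<otimes> \<alpha> w [^] j \<otimes> inv (\<alpha> g)" "\<alpha> g \<in> carrier G" "\<alpha> w \<in> {\<alpha> x, \<alpha> y, \<alpha> z}"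
      using gw im_conj[OF gw(1) w] v by auto
    then show "v \<in> Sigma_set G (apply_triple \<alpha> T)"
      unfolding Sigma_set_def apply_triple_def \<open>T = (x, y, z)\<close> by auto
  qed
qed

lemma Sigma_set_closed:
  assumes "T \<in> spherical_systems G"
  shows "Sigma_set G T \<subseteq> carrier G"
  using assms by (cases T) (auto simp: Sigma_set_def spherical_systems_def)

lemma moduli_moves_Bij:
  fixes m :: nat
  assumes fin: "finite (carrier G)" and f: "f \<in> moduli_moves G"
  defines "U \<equiv> ramification_structures G (m, m, m) (m, m, m)"
  shows "restrict f U \<in> Bij U"
proof -
  have "U \<subseteq> (carrier G \<times> carrier G \<times> carrier G) \<times> (carrier G \<times> carrier G \<times> carrier G)"
    by (auto simp: U_def ramification_structures_def spherical_systems_def)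
  then have finU: "finite U"
    by (rule finite_subset) (use fin in simp)
  have "f ` U \<subseteq> U \<and> inj_on f U"
  proof -
    consider (a) \<sigma> where "\<sigma> \<in> {braid1 G, braid2 G}" "f = map_prod \<sigma> id"
      | (b) \<sigma> where "\<sigma> \<in> {braid1 G, braid2 G}" "f = map_prod id \<sigma>"
      | (c) "f = prod.swap"
      | (d) \<alpha> where "\<alpha> \<in> auto G" "f = map_prod (apply_triple \<alpha>) (apply_triple \<alpha>)"
      using f unfolding moduli_moves_def by blast
    then show ?thesis
    proof cases
      case a
      then have "\<sigma> S \<in> spherical_systems G \<and> system_type G (\<sigma> S) = (m, m, m) \<and>
          Sigma_set G (\<sigma> S) = Sigma_set G S"
        if "S \<in> spherical_systems G" "system_type G S = (m, m, m)" for S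
        using that spherical_braid type_braid Sigma_set_braid by metis
      moreover have "inj_on \<sigma> (spherical_systems G)" using a inj_braid by blast
      ultimately show ?thesis
        by (fastforce simp: a(2) U_def ramification_structures_def disjoint_systems_def inj_on_def)
    next
      case b
      then have "\<sigma> S \<in> spherical_systems G \<and> system_type G (\<sigma> S) = (m, m, m) \<and>
          Sigma_set G (\<sigma> S) = Sigma_set G S"
        if "S \<in> spherical_systems G" "system_type G S = (m, m, m)" for S
        using that spherical_braid type_braid Sigma_set_braid by metis
      moreover have "inj_on \<sigma> (spherical_systems G)" using b inj_braid by blast
      ultimately show ?thesis
        by (fastforce simp: b(2) U_def ramification_structures_def disjoint_systems_def inj_on_def)
    next
      case c
      have "disjoint_systems G S S' = disjoint_systems G S' S" for S S'
        unfolding disjoint_systems_def by (metis Int_commute)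
      then have "f ` U \<subseteq> U"
        unfolding c U_def ramification_structures_def by auto
      then show ?thesis
        by (simp add: c)
    next
      case d
      interpret a: group_hom G G \<alpha>
        using d by unfold_locales (auto simp: auto_def)
      have inj: "inj_on \<alpha> (carrier G)"
        using d by (auto simp: auto_def Bij_def bij_betw_def)
      have inj3: "inj_on (apply_triple \<alpha>) (spherical_systems G)"
        using inj by (auto simp: inj_on_def apply_triple_def spherical_systems_def)
      have "disjoint_systems G (apply_triple \<alpha> S) (apply_triple \<alpha> S')"
        if "S \<in> spherical_systems G" "S' \<in> spherical_systems G" "disjoint_systems G S S'" for S S'
        using that d inj_on_image_Int[OF inj Sigma_set_closed Sigma_set_closed, of S S', symmetric]
        by (simp add: disjoint_systems_def apply_auto)
      then have "f ` U \<subseteq> U"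
        using d by (auto simp: U_def ramification_structures_def apply_auto)
      moreover have "inj_on f U"
        unfolding d(2) using inj3
        by (intro inj_on_subset[OF map_prod_inj_on[OF inj3 inj3]])
          (auto simp: U_def ramification_structures_def)
      ultimately show ?thesis by blast
    qed
  qed
  then have "bij_betw f U U"
    using finU by (simp add: bij_betw_def endo_inj_surj)
  then have "bij_betw (restrict f U) U U"
    by (subst bij_betw_cong[where g = f]) simp_all
  then show ?thesis
    by (simp add: Bij_def)
qed

end

lemma group_Zmod_square: "group (Zmod_square p)"
  by (simp add: Zmod_square_def DirProd_group)

lemma carrier_Zmod_square: "p > 0 \<Longrightarrow> carrier (Zmod_square p) = {0..<int p} \<times> {0..<int p}"
  by (simp add: Zmod_square_def carrier_integer_mod_group)

lemma Zmod_square_simps [simp]: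
  "\<one>\<^bsub>Zmod_square p\<^esub> = (0, 0)"
  "(a, b) \<otimes>\<^bsub>Zmod_square p\<^esub> (c, d) = ((a + c) mod int p, (b + d) mod int p)"
  by (simp_all add: Zmod_square_def)

lemma pow_Zmod_square:
  "(a, b) [^]\<^bsub>Zmod_square p\<^esub> (n::nat) = (int n * a mod int p, int n * b mod int p)"
proof -
  interpret group "Zmod_square p" by (rule group_Zmod_square)
  show ?thesis
    by (induction n) (simp_all add: nat_pow_def algebra_simps mod_simps)
qed

lemma comm_group_Zmod_square: "comm_group (Zmod_square p)"
  by (rule group.group_comm_groupI[OF group_Zmod_square])
    (auto simp: add.commute)

lemma ord_Zmod_square:
  assumes "prime p" "(a, b) \<in> carrier (Zmod_square p)" "(a, b) \<noteq> (0, 0)"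
  shows "group.ord (Zmod_square p) (a, b) = p"
proof -
  interpret group "Zmod_square p" by (rule group_Zmod_square)
  have p: "p > 0" "prime (int p)" using assms(1) prime_gt_0_nat by auto
  have "\<not> (int p dvd a \<and> int p dvd b)"
    using assms(2,3) p by (auto simp: carrier_Zmod_square zdvd_not_zless dest: zdvd_imp_le)
  then have "(int p dvd int n * a \<and> int p dvd int n * b) = (p dvd n)" for n
    using p(2) by (auto simp: prime_dvd_mult_iff)
  then show ?thesis
    using assms(2) by (subst ord_unique) (auto simp: pow_Zmod_square mod_eq_0_iff_dvd)
qed

lemma generate_Zmod_square:
  assumes p: "p > 0" and c: "{(a, b), (c, d), w} \<subseteq> carrier (Zmod_square p)"
    and cop: "coprime (a * d - b * c) (int p)"
  shows "generate (Zmod_square p) {(a, b), (c, d), w} = carrier (Zmod_square p)" (is "?H = _")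
proof
  interpret group "Zmod_square p" by (rule group_Zmod_square)
  show "?H \<subseteq> carrier (Zmod_square p)" using c by (rule generate_incl)
  have H: "subgroup ?H (Zmod_square p)" using c by (rule generate_is_subgroup)
  have pw: "x [^]\<^bsub>Zmod_square p\<^esub> (n::nat) \<in> ?H" if "x \<in> ?H" for x n
  proof (induction n)
    case 0
    show ?case unfolding nat_pow_0 by (rule generate.one)
  next
    case (Suc n)
    show ?case unfolding nat_pow_Suc using Suc that by (rule generate.eng)
  qed
  obtain k where "[(a * d - b * c) * k = 1] (mod int p)"
    using cop cong_solve_coprime_int by blast
  then have k: "(k * (a * d - b * c) * s) mod int p = s mod int p" for s
    by (metis cong_def cong_scalar_right mult.commute mult_1)
  show "carrier (Zmod_square p) \<subseteq> ?H"
  proof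
    fix x assume "x \<in> carrier (Zmod_square p)"
    then obtain s t where x: "x = (s, t)" "0 \<le> s" "s < int p" "0 \<le> t" "t < int p"
      using p by (auto simp: carrier_Zmod_square)
    define n m where "n = k * (s * d - t * c)" and "m = k * (a * t - b * s)"
    have e: "n * a + m * c = k * (a * d - b * c) * s" "n * b + m * d = k * (a * d - b * c) * t"
      by (simp_all add: n_def m_def algebra_simps)
    have nm: "int (nat (n mod int p)) = n mod int p" "int (nat (m mod int p)) = m mod int p"
      using p by simp_all
    have "(a, b) [^]\<^bsub>Zmod_square p\<^esub> nat (n mod int p)
          \<otimes>\<^bsub>Zmod_square p\<^esub> (c, d) [^]\<^bsub>Zmod_square p\<^esub> nat (m mod int p)
        = ((n * a + m * c) mod int p, (n * b + m * d) mod int p)"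
      unfolding pow_Zmod_square nm by (simp add: mod_simps)
    also have "\<dots> = x" using x by (simp add: e k)
    finally show "x \<in> ?H"
      using subgroup.m_closed[OF H pw pw] by (metis generate.incl insert_iff)
  qed
qed

lemma Sigma_set_Zmod_square:
  assumes "T = (x, y, z)" "{x, y, z} \<subseteq> carrier (Zmod_square p)"
  shows "Sigma_set (Zmod_square p) T =
    {(int n * a mod int p, int n * b mod int p) | n a b. (a, b) \<in> {x, y, z}}"
proof -
  interpret comm_group "Zmod_square p" by (rule comm_group_Zmod_square)
  have conj: "g \<otimes>\<^bsub>Zmod_square p\<^esub> w [^]\<^bsub>Zmod_square p\<^esub> (j::nat) \<otimes>\<^bsub>Zmod_square p\<^esub> inv\<^bsub>Zmod_square p\<^esub> g
      = w [^]\<^bsub>Zmod_square p\<^esub> j"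
    if "g \<in> carrier (Zmod_square p)" "w \<in> {x, y, z}" for g w j
  proof -
    have "w \<in> carrier (Zmod_square p)" using that assms(2) by auto
    then show ?thesis
      using that(1) by (metis inv_closed m_assoc m_comm nat_pow_closed r_inv r_one)
  qed
  have "Sigma_set (Zmod_square p) T = {w [^]\<^bsub>Zmod_square p\<^esub> j | w (j::nat). w \<in> {x, y, z}}"
    unfolding Sigma_set_def assms(1) prod.case
    using conj one_closed by (intro Collect_cong) metis
  then show ?thesis
    by (auto simp: pow_Zmod_square)
qed

lemma ramification_structures_Zmod_square_nonempty:
  assumes "prime p" "p \<ge> 5"
  shows "ramification_structures (Zmod_square p) (p, p, p) (p, p, p) \<noteq> {}"
proof -
  define q where "q = int p"
  define T1 :: "(int \<times> int) triple" where "T1 = ((1, 0), (0, 1), (q - 1, q - 1))"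
  define T2 :: "(int \<times> int) triple" where "T2 = ((1, 2), (1, q - 1), (q - 2, q - 1))"
  have p: "p > 0" "q \<ge> 5" "prime q" using assms by (auto simp: q_def)
  have pr: "coprime k q" if "0 < k" "k < q" for k
    using p(3) that by (metis coprime_commute prime_imp_coprime zdvd_not_zless)
  have c1: "{(1, 0), (0, 1), (q - 1, q - 1)} \<subseteq> carrier (Zmod_square p)"
    and c2: "{(1, 2), (1, q - 1), (q - 2, q - 1)} \<subseteq> carrier (Zmod_square p)"
    using p by (auto simp: carrier_Zmod_square q_def)
  have "1 * (q - 1) - 2 * 1 = q - 3" by simp
  then have "coprime (1 * (q - 1) - 2 * 1) q"
    using pr[of "q - 3"] p by simp
  then have "generate (Zmod_square p) {(1, 2), (1, q - 1), (q - 2, q - 1)} = carrier (Zmod_square p)"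
    using generate_Zmod_square[OF p(1) c2] by (simp add: q_def)
  moreover have "generate (Zmod_square p) {(1, 0), (0, 1), (q - 1, q - 1)} = carrier (Zmod_square p)"
    using generate_Zmod_square[OF p(1) c1] by simp
  ultimately have T: "T1 \<in> spherical_systems (Zmod_square p)" "T2 \<in> spherical_systems (Zmod_square p)"
    using c1 c2 p by (auto simp: spherical_systems_def T1_def T2_def mod_simps simp flip: q_def)
  have ord: "system_type (Zmod_square p) T1 = (p, p, p)" "system_type (Zmod_square p) T2 = (p, p, p)"
    using c1 c2 p(2) ord_Zmod_square[OF assms(1)] by (simp_all add: system_type_def T1_def T2_def)
  have key: "(int n * a mod q, int n * b mod q) = (0, 0)"
    if eq: "(int n * a mod q, int n * b mod q) = (int m * c mod q, int m * d mod q)"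
      and ab: "(a, b) \<in> {(1, 0), (0, 1), (q - 1, q - 1)}"
      and cd: "(c, d) \<in> {(1, 2), (1, q - 1), (q - 2, q - 1)}" for n m a b c d
  proof -
    have "[int n * a = int m * c] (mod q)" "[int n * b = int m * d] (mod q)"
      using eq by (simp_all add: cong_def)
    then have "[int n * a * d - int n * b * c = int m * c * d - int m * d * c] (mod q)"
      by (intro cong_diff cong_scalar_right)
    then have "q dvd int n * (a * d - b * c)"
      by (simp add: cong_0_iff algebra_simps)
    moreover have "\<exists>e\<in>{-2, -1, 1, 2}. [a * d - b * c = e] (mod q)"
    proof -
      have *: "[u = e] (mod q)" if "u - e = v * q" for u e v
        using that by (simp add: cong_iff_dvd_diff)
      consider "a = 1" "b = 0" | "a = 0" "b = 1" | "a = q - 1" "b = q - 1"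
        using ab by auto
      then show ?thesis
      proof cases
        case 1
        then show ?thesis using cd *[of 2 2 0] *[of "q-1" "-1" 1] by auto
      next
        case 2
        then show ?thesis using cd *[of "-1" "-1" 0] *[of "2-q" 2 "-1"] by auto
      next
        case 3
        have "(q-1)*2 - (q-1)*1 - (-1) = 1 * q" "(q-1)*(q-1) - (q-1)*1 - 2 = (q-3) * q"
          "(q-1)*(q-1) - (q-1)*(q-2) - (-1) = 1 * q"
          by (simp_all add: algebra_simps)
        then show ?thesis using 3 cd * by (elim insertE) blast+
      qed
    qed
    then obtain e where e: "e \<in> {-2, -1, 1, 2}" "[a * d - b * c = e] (mod q)" by blast
    have "coprime e q" using e(1) pr[of 1] pr[of 2] p by auto
    then have "coprime (a * d - b * c) q"
      using e(2) cong_imp_coprime cong_sym by blast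
    ultimately have "q dvd int n"
      by (metis coprime_commute coprime_dvd_mult_left_iff)
    then show ?thesis by auto
  qed
  have "Sigma_set (Zmod_square p) T1 \<inter> Sigma_set (Zmod_square p) T2 \<subseteq> {(0, 0)}"
    unfolding Sigma_set_Zmod_square[OF T1_def c1] Sigma_set_Zmod_square[OF T2_def c2] q_def[symmetric]
    using key by blast
  moreover have "(0, 0) \<in> Sigma_set (Zmod_square p) T1 \<inter> Sigma_set (Zmod_square p) T2"
    unfolding Sigma_set_Zmod_square[OF T1_def c1] Sigma_set_Zmod_square[OF T2_def c2]
    by (auto intro!: exI[of _ "0::nat"]) blast+
  ultimately have "disjoint_systems (Zmod_square p) T1 T2"
    by (auto simp: disjoint_systems_def)
  then have "(T1, T2) \<in> ramification_structures (Zmod_square p) (p, p, p) (p, p, p)"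
    using T ord unfolding ramification_structures_def mem_Collect_eq prod.case by blast
  then show ?thesis by blast
qed

end

theory Submission
  imports Defs
begin

text \<open>
  Since \<open>\<chi>(S\<^sub>p) = (p - 3)\<^sup>2/4\<close>, the claim is that the number of orbits grows like \<open>p\<^sup>4\<close>.

  Write \<open>T\<^sub>0 = (e\<^sub>1, e\<^sub>2, - e\<^sub>1 - e\<^sub>2)\<close>. A spherical 3-system of generators of \<open>(\<int>/p\<int>)\<^sup>2\<close> is a basis
  \<open>(x\<^sub>1, x\<^sub>2)\<close> together with \<open>- x\<^sub>1 - x\<^sub>2\<close>, so the automorphism group, which is \<open>GL\<^sub>2\<close> over the
  field with \<open>p\<close> elements, acts transitively on these systems. Every orbit therefore has a
  representative \<open>(T\<^sub>0, T)\<close>, and there are at most \<open>p\<^sup>4\<close> choices for \<open>T\<close>: this is the upper bound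
  (\<open>beauville_count_le_if_transitive\<close>).

  For the lower bound it is enough that a bounded number of pairs \<open>(T\<^sub>0, T)\<close> lie in a common orbit
  and that there are at least a constant times \<open>p\<^sup>4\<close> of them. In an abelian group the braid moves
  merely permute the three entries of a system, so two pairs in one orbit have the same sets of
  entries up to a common automorphism and up to exchange of the two systems
  (\<open>orbit_entrywise_equivalent\<close>). If both pairs start with \<open>T\<^sub>0\<close>, then the automorphism maps the
  entries of a generating system to those of \<open>T\<^sub>0\<close>; this leaves at most \<open>27\<close> automorphisms, then
  at most \<open>27\<close> second systems, and a factor \<open>2\<close> for the exchange (\<open>card_orbit_fibre_le\<close>).

  A system \<open>T\<close> is disjoint from \<open>T\<^sub>0\<close> as soon as none of its entries lies on the lines spanned by
  \<open>e\<^sub>1\<close>, \<open>e\<^sub>2\<close> and \<open>e\<^sub>1 + e\<^sub>2\<close>. Taking \<open>x\<^sub>1\<close> and \<open>x\<^sub>2\<close> in a box of side about \<open>p/4\<close> strictly above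
  the diagonal ensures this for all three entries at once, and excluding the vanishing determinants
  costs only a lower-order term (\<open>card_slice_Zmod_square_ge\<close>).
\<close>

section \<open>The action on ramification structures\<close>

text \<open>
  Finiteness of \<open>A\<close> takes care of the inverses: an injective map of \<open>A\<close> into itself is onto \<open>A\<close>.
\<close>

lemma generate_BijGroup_invariant:
  assumes gens: "H \<subseteq> Bij U" and A: "A \<subseteq> U" "finite A"
    and inv: "\<And>f. f \<in> H \<Longrightarrow> f ` A \<subseteq> A"
    and f: "f \<in> generate (BijGroup U) H"
  shows "f ` A \<subseteq> A"
  using f
proof (induction rule: generate.induct)
  case one
  then show ?case using A by (auto simp: BijGroup_def)
next
  case (incl h)
  then show ?case by (rule inv)
next
  case (inv h)
  then have h: "h \<in> Bij U" using gens by blast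
  then have inj: "inj_on h U" by (simp add: Bij_def bij_betw_def)
  then have "h ` A = A"
    using endo_inj_surj[OF A(2) assms(4)[OF inv]] A(1) inj_on_subset by blast
  then have "inv_into U h y \<in> A" if y: "y \<in> A" for y
  proof -
    obtain z where "z \<in> A" "y = h z" using y \<open>h ` A = A\<close> by blast
    then show ?thesis using A(1) inj by (simp add: inv_into_f_f subset_iff)
  qed
  then show ?case using A(1) by (auto simp: inv_BijGroup[OF h])
next
  case (eng h1 h2)
  have "generate (BijGroup U) H \<subseteq> Bij U"
    using group.generate_incl[OF group_BijGroup, of H U] gens by (simp add: BijGroup_def)
  with eng have "h1 \<in> Bij U" "h2 \<in> Bij U" by auto
  then show ?case using eng A(1) by (fastforce simp: BijGroup_def compose_def)
qed

lemma (in group) moduli_group_action: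
  assumes fin: "finite (carrier G)"
  defines "U \<equiv> \<lambda>m. ramification_structures G (m, m, m) (m, m, m)"
  shows "group_action (moduli_group G m) (U m) (\<lambda>f. f)"
proof -
  define H where "H = generate (BijGroup (U m)) ((\<lambda>f. restrict f (U m)) ` moduli_moves G)"
  have "(\<lambda>f. restrict f (U m)) ` moduli_moves G \<subseteq> carrier (BijGroup (U m))"
    using moduli_moves_Bij[OF fin] by (auto simp: U_def BijGroup_def)
  then have sub: "subgroup H (BijGroup (U m))"
    unfolding H_def by (rule group.generate_is_subgroup[OF group_BijGroup])
  have eq: "moduli_group G m = (BijGroup (U m))\<lparr>carrier := H\<rparr>"
    by (simp add: moduli_group_def H_def U_def Let_def)
  show ?thesis
    unfolding eq group_action_def group_hom_def group_hom_axioms_def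
    using subgroup.subgroup_is_group[OF sub group_BijGroup] group_BijGroup
      subgroup.mem_carrier[OF sub]
    by (auto simp: hom_def)
qed

lemma (in group) finite_ramification_structures:
  assumes "finite (carrier G)"
  shows "finite (ramification_structures G \<tau>1 \<tau>2)"
proof (rule finite_subset)
  show "ramification_structures G \<tau>1 \<tau>2 \<subseteq>
      (carrier G \<times> carrier G \<times> carrier G) \<times> (carrier G \<times> carrier G \<times> carrier G)"
    by (auto simp: ramification_structures_def spherical_systems_def)
qed (use assms in simp)

section \<open>An upper bound from transitivity\<close>

lemma (in group) spherical_systems_third:
  assumes "(x, y, z) \<in> spherical_systems G"
  shows "z = inv (x \<otimes> y)"
  using assms inv_equality[of z "x \<otimes> y"]
  by (auto simp: spherical_systems_def) (metis inv_comm inv_equality m_closed)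

lemma (in group) card_spherical_systems_le:
  assumes "finite (carrier G)"
  shows "card (spherical_systems G) \<le> (order G)\<^sup>2"
proof -
  have "inj_on (\<lambda>(x, y, z). (x, y)) (spherical_systems G)"
    by (rule inj_onI) (auto dest!: spherical_systems_third)
  moreover have "(\<lambda>(x, y, z). (x, y)) ` spherical_systems G \<subseteq> carrier G \<times> carrier G"
    by (auto simp: spherical_systems_def)
  ultimately have "card (spherical_systems G) \<le> card (carrier G \<times> carrier G)"
    using assms by (intro card_inj_on_le) auto
  then show ?thesis by (simp add: order_def power2_eq_square card_cartesian_product)
qed

text \<open>
  Every orbit contains a pair that begins with \<open>T0\<close>, and is determined by the second component
  of that pair.
\<close>

lemma (in group) beauville_count_le_if_transitive:
  assumes fin: "finite (carrier G)"
    and trans: "\<And>T. T \<in> spherical_systems G \<Longrightarrow> \<exists>\<alpha>\<in>auto G. apply_triple \<alpha> T = T0"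
  shows "beauville_count G m \<le> (order G)\<^sup>2"
proof -
  define U where "U = ramification_structures G (m, m, m) (m, m, m)"
  define orb where "orb = orbit (moduli_group G m) (\<lambda>f. f)"
  interpret act: group_action "moduli_group G m" U "\<lambda>f. f"
    unfolding U_def by (rule moduli_group_action[OF fin])
  have "orbits (moduli_group G m) U (\<lambda>f. f) \<subseteq> (\<lambda>T. orb (T0, T)) ` spherical_systems G"
  proof
    fix O' assume O': "O' \<in> orbits (moduli_group G m) U (\<lambda>f. f)"
    then obtain T1 T2 where x: "(T1, T2) \<in> U" and O_eq: "O' = orb (T1, T2)"
      by (auto simp: orbits_def orb_def)
    then have T: "T1 \<in> spherical_systems G" "T2 \<in> spherical_systems G"
      by (auto simp: U_def ramification_structures_def)
    obtain \<alpha> where \<alpha>: "\<alpha> \<in> auto G" "apply_triple \<alpha> T1 = T0"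
      using trans[OF T(1)] by blast
    define f where "f = restrict (map_prod (apply_triple \<alpha>) (apply_triple \<alpha>)) U"
    have "map_prod (apply_triple \<alpha>) (apply_triple \<alpha>) \<in> moduli_moves G"
      using \<alpha> by (auto simp: moduli_moves_def)
    then have f: "f \<in> carrier (moduli_group G m)"
      by (auto simp: f_def moduli_group_def U_def Let_def intro: generate.incl)
    have fx: "f (T1, T2) = (T0, apply_triple \<alpha> T2)"
      using x \<alpha> by (simp add: f_def)
    then have "(T0, apply_triple \<alpha> T2) \<in> O'"
      unfolding O_eq orb_def orbit_def mem_Collect_eq using f by metis
    moreover have y: "(T0, apply_triple \<alpha> T2) \<in> U"
      using act.element_image[OF f x fx] .
    then have "(T0, apply_triple \<alpha> T2) \<in> orb (T0, apply_triple \<alpha> T2)"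
      using act.orbit_refl by (simp add: orb_def)
    moreover have "orb (T0, apply_triple \<alpha> T2) \<in> orbits (moduli_group G m) U (\<lambda>f. f)"
      using y unfolding orbits_def orb_def by blast
    ultimately have "O' = orb (T0, apply_triple \<alpha> T2)"
      using act.disjoint_union[OF O'] by blast
    then show "O' \<in> (\<lambda>T. orb (T0, T)) ` spherical_systems G"
      using apply_auto(1)[OF T(2) \<alpha>(1)] by blast
  qed
  moreover have finS: "finite (spherical_systems G)"
    by (rule finite_subset[of _ "carrier G \<times> carrier G \<times> carrier G"])
      (use fin in \<open>auto simp: spherical_systems_def\<close>)
  ultimately have "beauville_count G m \<le> card (spherical_systems G)"
    unfolding beauville_count_def U_def[symmetric] by (rule surj_card_le[rotated])
  also have "\<dots> \<le> (order G)\<^sup>2" by (rule card_spherical_systems_le[OF fin])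
  finally show ?thesis .
qed

section \<open>A lower bound for abelian groups\<close>

definition entries :: "'a triple \<Rightarrow> 'a set" where
  "entries = (\<lambda>(x, y, z). {x, y, z})"

text \<open>
  For an abelian group this relation is coarser than lying in one orbit: it forgets the order of
  the entries, so the braid moves do not affect it, and only the automorphisms and the exchange
  are left.
\<close>

definition entrywise_equivalent ::
    "('a, 'b) monoid_scheme \<Rightarrow> 'a triple \<times> 'a triple \<Rightarrow> 'a triple \<times> 'a triple \<Rightarrow> bool" where
  "entrywise_equivalent G = (\<lambda>(S1, S2) (T1, T2). \<exists>\<alpha>\<in>auto G.
     entries T1 = \<alpha> ` entries S1 \<and> entries T2 = \<alpha> ` entries S2 \<or>
     entries T1 = \<alpha> ` entries S2 \<and> entries T2 = \<alpha> ` entries S1)"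

lemma (in comm_group) entries_braid:
  assumes "T \<in> spherical_systems G" "\<sigma> \<in> {braid1 G, braid2 G}"
  shows "entries (\<sigma> T) = entries T"
proof -
  have "a \<otimes> b \<otimes> inv a = b" if "a \<in> carrier G" "b \<in> carrier G" for a b
    using that by (metis inv_solve_right m_closed m_comm)
  then show ?thesis
    using assms
    by (cases T) (auto simp: spherical_systems_def braid1_def braid2_def entries_def)
qed

lemma (in comm_group) entrywise_equivalent_move:
  assumes x: "x \<in> ramification_structures G \<tau>1 \<tau>2" and y: "y \<in> ramification_structures G \<tau>1 \<tau>2"
    and xy: "entrywise_equivalent G x y" and f: "f \<in> moduli_moves G"
  shows "entrywise_equivalent G x (f y)"
proof -
  obtain S1 S2 T1 T2 where eq: "x = (S1, S2)" "y = (T1, T2)" by (cases x, cases y)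
  have T: "T1 \<in> spherical_systems G" "T2 \<in> spherical_systems G"
    and S: "S1 \<in> spherical_systems G" "S2 \<in> spherical_systems G"
    using x y by (auto simp: eq ramification_structures_def)
  obtain \<alpha> where \<alpha>: "\<alpha> \<in> auto G"
    "entries T1 = \<alpha> ` entries S1 \<and> entries T2 = \<alpha> ` entries S2 \<or>
     entries T1 = \<alpha> ` entries S2 \<and> entries T2 = \<alpha> ` entries S1"
    using xy by (auto simp: eq entrywise_equivalent_def)
  consider (a) \<sigma> where "\<sigma> \<in> {braid1 G, braid2 G}" "f = map_prod \<sigma> id"
    | (b) \<sigma> where "\<sigma> \<in> {braid1 G, braid2 G}" "f = map_prod id \<sigma>"
    | (c) "f = prod.swap"
    | (d) \<beta> where "\<beta> \<in> auto G" "f = map_prod (apply_triple \<beta>) (apply_triple \<beta>)"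
    using f unfolding moduli_moves_def by blast
  then show ?thesis
  proof cases
    case a
    then show ?thesis using \<alpha> entries_braid[OF T(1) a(1)]
      by (auto simp: eq entrywise_equivalent_def)
  next
    case b
    then show ?thesis using \<alpha> entries_braid[OF T(2) b(1)]
      by (auto simp: eq entrywise_equivalent_def)
  next
    case c
    then show ?thesis using \<alpha> by (auto simp: eq entrywise_equivalent_def)
  next
    case d
    define \<gamma> where "\<gamma> = compose (carrier G) \<beta> \<alpha>"
    have "\<gamma> = \<beta> \<otimes>\<^bsub>BijGroup (carrier G)\<^esub> \<alpha>"
      using \<alpha>(1) d(1) by (simp add: \<gamma>_def BijGroup_def auto_def)
    then have \<gamma>: "\<gamma> \<in> auto G"
      using subgroup.m_closed[OF subgroup_auto d(1) \<alpha>(1)] by simp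
    have ent: "entries (apply_triple \<beta> T) = \<beta> ` entries T" for T
      by (cases T) (simp add: entries_def apply_triple_def)
    have "entries S1 \<subseteq> carrier G" "entries S2 \<subseteq> carrier G"
      using S by (auto simp: spherical_systems_def entries_def)
    then have "\<beta> ` \<alpha> ` entries S1 = \<gamma> ` entries S1" "\<beta> ` \<alpha> ` entries S2 = \<gamma> ` entries S2"
      by (auto simp: \<gamma>_def compose_def image_image subset_iff)
    then show ?thesis
      using \<alpha>(2) unfolding entrywise_equivalent_def eq d(2) prod.case map_prod_simp ent
      by (intro bexI[OF _ \<gamma>]) metis
  qed
qed

text \<open>
  The set of all structures equivalent to \<open>x\<close> is finite and stable under the moves, hence under the
  group that they generate, and it contains \<open>x\<close>.
\<close>

lemma (in comm_group) orbit_entrywise_equivalent: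
  assumes fin: "finite (carrier G)" and x: "x \<in> ramification_structures G (m, m, m) (m, m, m)"
    and y: "y \<in> orbit (moduli_group G m) (\<lambda>f. f) x"
  shows "entrywise_equivalent G x y"
proof -
  define U where "U = ramification_structures G (m, m, m) (m, m, m)"
  define A where "A = {y \<in> U. entrywise_equivalent G x y}"
  obtain f where f: "f \<in> generate (BijGroup U) ((\<lambda>f. restrict f U) ` moduli_moves G)" "y = f x"
    using y by (auto simp: orbit_def moduli_group_def U_def Let_def)
  have bij: "restrict f U \<in> Bij U" if "f \<in> moduli_moves G" for f
    unfolding U_def using fin that by (rule moduli_moves_Bij)
  have AU: "A \<subseteq> U" by (auto simp: A_def)
  then have finA: "finite A"
    using finite_ramification_structures[OF fin] U_def finite_subset by metis
  have "g ` A \<subseteq> A" if g: "g \<in> (\<lambda>f. restrict f U) ` moduli_moves G" for g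
  proof -
    obtain h where h: "h \<in> moduli_moves G" "g = restrict h U" using g by blast
    have "g z \<in> U" if "z \<in> U" for z
      unfolding h(2) using Bij_imp_funcset[OF bij[OF h(1)]] that by (rule Pi_mem)
    then show ?thesis
      using entrywise_equivalent_move[OF x _ _ h(1)]
      by (auto simp: A_def h(2) U_def)
  qed
  then have "f ` A \<subseteq> A"
    using bij by (intro generate_BijGroup_invariant[OF _ AU finA _ f(1)]) auto
  moreover have "x \<in> A"
  proof -
    obtain S1 S2 where eq: "x = (S1, S2)" by (cases x)
    have "entries S1 \<subseteq> carrier G" "entries S2 \<subseteq> carrier G"
      using x by (auto simp: eq ramification_structures_def spherical_systems_def entries_def)
    then have "entrywise_equivalent G x x"
      unfolding entrywise_equivalent_def eq prod.case
      by (intro bexI[OF _ id_in_auto] disjI1) (auto simp: subset_iff image_iff)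
    then show ?thesis using x by (simp add: A_def U_def)
  qed
  ultimately show ?thesis using f(2) by (auto simp: A_def)
qed

lemma (in group) auto_eqI:
  assumes \<alpha>: "\<alpha> \<in> auto G" and \<beta>: "\<beta> \<in> auto G"
    and X: "X \<subseteq> carrier G" "generate G X = carrier G"
    and eq: "\<And>x. x \<in> X \<Longrightarrow> \<alpha> x = \<beta> x"
  shows "\<alpha> = \<beta>"
proof -
  interpret a: group_hom G G \<alpha> using \<alpha> by unfold_locales (auto simp: auto_def)
  interpret b: group_hom G G \<beta> using \<beta> by unfold_locales (auto simp: auto_def)
  have "\<alpha> g = \<beta> g" if "g \<in> generate G X" for g
    using that
  proof (induction rule: generate.induct)
    case (inv h)
    then show ?case using eq X(1) by (metis a.hom_inv b.hom_inv subsetD)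
  next
    case (eng h1 h2)
    then show ?case using X by simp
  qed (use eq in auto)
  then show ?thesis
    using \<alpha> \<beta> X(2) by (intro extensionalityI[of _ "carrier G"]) (auto simp: auto_def Bij_def)
qed

lemma card_entries_le: "card (entries T) \<le> 3"
  by (cases T) (auto simp: entries_def card_insert_if)

lemma finite_entries: "finite (entries T)"
  by (cases T) (auto simp: entries_def)

lemma card_triples_le:
  assumes "finite E" "card E \<le> 3"
  shows "finite {T. entries T = E}" "card {T. entries T = E} \<le> 27"
proof -
  have sub: "{T. entries T = E} \<subseteq> E \<times> E \<times> E" by (auto simp: entries_def)
  then show "finite {T. entries T = E}" using assms(1) finite_subset by blast
  have "card {T. entries T = E} \<le> card (E \<times> E \<times> E)"
    using sub assms(1) by (intro card_mono) auto
  also have "\<dots> = card E ^ 3" by (simp add: card_cartesian_product power3_eq_cube)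
  also have "\<dots> \<le> 3 ^ 3" using assms(2) by (rule power_mono) simp
  finally show "card {T. entries T = E} \<le> 27" by simp
qed

text \<open>
  An automorphism is determined by the images of the three generators in \<open>S\<close>, each of which is
  one of the at most three entries of \<open>T\<close>.
\<close>

lemma (in group) card_autos_between_le:
  assumes S: "S \<in> spherical_systems G"
  defines "A \<equiv> \<lambda>T. {\<alpha> \<in> auto G. \<alpha> ` entries S = entries T}"
  shows "finite (A T)" "card (A T) \<le> 27"
proof -
  obtain x y z where xyz: "S = (x, y, z)" by (cases S)
  have c: "entries S \<subseteq> carrier G" "generate G (entries S) = carrier G"
    using S by (auto simp: xyz spherical_systems_def entries_def)
  have inj: "inj_on (\<lambda>\<alpha>. apply_triple \<alpha> S) (A T)"
    using auto_eqI[OF _ _ c]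
    by (intro inj_onI) (auto simp: A_def xyz entries_def apply_triple_def)
  have im: "(\<lambda>\<alpha>. apply_triple \<alpha> S) ` A T \<subseteq> {S'. entries S' = entries T}"
    by (auto simp: A_def xyz entries_def apply_triple_def)
  note fin = card_triples_le[OF finite_entries card_entries_le, of T]
  show "finite (A T)" using inj_on_finite[OF inj im fin(1)] .
  show "card (A T) \<le> 27" using card_inj_on_le[OF inj im fin(1)] fin(2) by simp
qed

text \<open>
  The bound is \<open>1458 = 2 \<sqdot> 27 \<sqdot> 27\<close>: whether the two systems are exchanged, the automorphism, and
  the arrangement of the entries of \<open>T'\<close>. Fixing \<open>S\<close> is what leaves so few automorphisms. The
  point is that the bound is the same for all finite abelian groups.
\<close>

lemma (in comm_group) card_orbit_fibre_le:
  assumes fin: "finite (carrier G)"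
    and x: "(S, T) \<in> ramification_structures G (m, m, m) (m, m, m)"
  defines "F \<equiv> {T'. (S, T') \<in> orbit (moduli_group G m) (\<lambda>f. f) (S, T)}"
  shows "finite F" "card F \<le> 1458"
proof -
  have ST: "S \<in> spherical_systems G" "T \<in> spherical_systems G"
    using x by (auto simp: ramification_structures_def)
  define A where "A R = {\<alpha> \<in> auto G. \<alpha> ` entries R = entries S}" for R
  \<comment> \<open>The case without exchange leads to \<open>B S T\<close>, the one with exchange to \<open>B T S\<close>.\<close>
  define B where "B R R' = (\<Union>\<alpha>\<in>A R. {T'. entries T' = \<alpha> ` entries R'})" for R R'
  have B: "finite (B R R') \<and> card (B R R') \<le> 729" if "R \<in> spherical_systems G" for R R'
  proof
    have A: "finite (A R)" "card (A R) \<le> 27"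
      using card_autos_between_le[OF that] by (simp_all add: A_def)
    have im: "finite (\<alpha> ` entries R')" "card (\<alpha> ` entries R') \<le> 3" for \<alpha> :: "'a \<Rightarrow> 'a"
      using card_image_le[OF finite_entries] card_entries_le finite_entries le_trans by blast+
    show "finite (B R R')" unfolding B_def using A(1) card_triples_le[OF im] by blast
    have "card (B R R') \<le> (\<Sum>\<alpha>\<in>A R. card {T'. entries T' = \<alpha> ` entries R'})"
      unfolding B_def by (rule card_UN_le[OF A(1)])
    also have "\<dots> \<le> card (A R) * 27"
      using sum_bounded_above[of "A R" "\<lambda>\<alpha>. card {T'. entries T' = \<alpha> ` entries R'}" 27]
        card_triples_le(2)[OF im] by simp
    finally show "card (B R R') \<le> 729" using A(2) by simp
  qed
  have "F \<subseteq> B S T \<union> B T S"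
  proof
    fix T' assume "T' \<in> F"
    then have "entrywise_equivalent G (S, T) (S, T')"
      using orbit_entrywise_equivalent[OF fin x] by (simp add: F_def)
    then obtain \<alpha> where "\<alpha> \<in> auto G"
      "entries S = \<alpha> ` entries S \<and> entries T' = \<alpha> ` entries T \<or>
       entries S = \<alpha> ` entries T \<and> entries T' = \<alpha> ` entries S"
      by (auto simp: entrywise_equivalent_def)
    then have "\<alpha> \<in> A S \<and> entries T' = \<alpha> ` entries T \<or> \<alpha> \<in> A T \<and> entries T' = \<alpha> ` entries S"
      unfolding A_def mem_Collect_eq by metis
    then show "T' \<in> B S T \<union> B T S" by (auto simp: B_def)
  qed
  moreover have fin': "finite (B S T \<union> B T S)" using B[OF ST(1)] B[OF ST(2)] by simp
  moreover have "card (B S T \<union> B T S) \<le> 1458"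
    using card_Un_le[of "B S T" "B T S"] B[OF ST(1), of T] B[OF ST(2), of S] by linarith
  ultimately show "finite F" "card F \<le> 1458"
    using finite_subset[of F, OF _ fin'] card_mono[OF fin', of F] by linarith+
qed

text \<open>
  The map that sends \<open>T\<close> to the orbit of \<open>(S, T)\<close> has fibres of at most \<open>1458\<close> elements.
\<close>

lemma (in comm_group) card_slice_le_beauville_count:
  assumes fin: "finite (carrier G)"
  shows "card {T. (S, T) \<in> ramification_structures G (m, m, m) (m, m, m)}
    \<le> 1458 * beauville_count G m"
proof -
  define U where "U = ramification_structures G (m, m, m) (m, m, m)"
  define V where "V = {T. (S, T) \<in> U}"
  define orb where "orb T = orbit (moduli_group G m) (\<lambda>f. f) (S, T)" for T
  interpret act: group_action "moduli_group G m" U "\<lambda>f. f"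
    unfolding U_def by (rule moduli_group_action[OF fin])
  have finU: "finite U" unfolding U_def by (rule finite_ramification_structures[OF fin])
  have finO: "finite (orbits (moduli_group G m) U (\<lambda>f. f))"
  proof -
    have "orbits (moduli_group G m) U (\<lambda>f. f) = orbit (moduli_group G m) (\<lambda>f. f) ` U"
      unfolding orbits_def by blast
    then show ?thesis using finU by simp
  qed
  have sub: "orb ` V \<subseteq> orbits (moduli_group G m) U (\<lambda>f. f)"
    unfolding orbits_def orb_def V_def by blast
  then have finI: "finite (orb ` V)" using finO finite_subset by blast
  have fibre: "card {T' \<in> V. orb T' = orb T} \<le> 1458" if "T \<in> V" for T
  proof -
    have x: "(S, T) \<in> ramification_structures G (m, m, m) (m, m, m)"
      using that by (simp add: V_def U_def)
    have "{T' \<in> V. orb T' = orb T} \<subseteq> {T'. (S, T') \<in> orbit (moduli_group G m) (\<lambda>f. f) (S, T)}"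
      using act.orbit_refl unfolding V_def orb_def by blast
    from card_mono[OF card_orbit_fibre_le(1)[OF fin x] this] show ?thesis
      using card_orbit_fibre_le(2)[OF fin x] by (rule le_trans)
  qed
  have "V = (\<Union>C\<in>orb ` V. {T' \<in> V. orb T' = C})" by auto
  then have "card V \<le> (\<Sum>C\<in>orb ` V. card {T' \<in> V. orb T' = C})"
    using card_UN_le[OF finI, of "\<lambda>C. {T' \<in> V. orb T' = C}"] by simp
  also have "\<dots> \<le> (\<Sum>C\<in>orb ` V. 1458)"
    by (rule sum_mono) (use fibre in blast)
  also have "\<dots> = 1458 * card (orb ` V)" by simp
  finally have "card V \<le> 1458 * card (orb ` V)" .
  moreover have "card (orb ` V) \<le> beauville_count G m"
    unfolding beauville_count_def U_def[symmetric] using sub finO by (rule card_mono[rotated])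
  ultimately show ?thesis by (simp add: V_def U_def)
qed

section \<open>Transitivity for \<open>(\<int>/p\<int>)\<^sup>2\<close>\<close>

lemma finite_Zmod_square: "p > 0 \<Longrightarrow> finite (carrier (Zmod_square p))"
  by (simp add: carrier_Zmod_square)

lemma order_Zmod_square: "p > 0 \<Longrightarrow> order (Zmod_square p) = p\<^sup>2"
  by (simp add: order_def carrier_Zmod_square card_cartesian_product power2_eq_square)

definition standard_system :: "nat \<Rightarrow> (int \<times> int) triple" where
  "standard_system p = ((1, 0), (0, 1), (int p - 1, int p - 1))"

lemma standard_system_spherical:
  assumes "p \<ge> 2"
  shows "standard_system p \<in> spherical_systems (Zmod_square p)"
proof -
  have c: "{(1, 0), (0, 1), (int p - 1, int p - 1)} \<subseteq> carrier (Zmod_square p)"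
    using assms by (auto simp: carrier_Zmod_square)
  then have "generate (Zmod_square p) {(1, 0), (0, 1), (int p - 1, int p - 1)}
      = carrier (Zmod_square p)"
    using assms by (intro generate_Zmod_square) auto
  then show ?thesis
    using c assms by (simp add: spherical_systems_def standard_system_def)
qed

text \<open>
  The witness is the linear map whose matrix has the first two entries of \<open>T\<close> as columns. Its image
  is a subgroup that contains the entries of \<open>T\<close>, so it is everything, and a surjective
  endomorphism of a finite group is bijective.
\<close>

lemma auto_standard_system_to:
  assumes p: "p \<ge> 2" and T: "T \<in> spherical_systems (Zmod_square p)"
  shows "\<exists>\<beta>\<in>auto (Zmod_square p). apply_triple \<beta> (standard_system p) = T"
proof -
  let ?G = "Zmod_square p" and ?q = "int p"
  interpret comm_group ?G by (rule comm_group_Zmod_square)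
  have p0: "p > 0" using p by simp
  obtain a b c d w where Teq: "T = ((a, b), (c, d), w)" by (metis surj_pair)
  have car: "(a, b) \<in> carrier ?G" "(c, d) \<in> carrier ?G" "w \<in> carrier ?G"
    and gen: "generate ?G {(a, b), (c, d), w} = carrier ?G"
    using T by (auto simp: Teq spherical_systems_def)
  have w: "w = inv\<^bsub>?G\<^esub> ((a, b) \<otimes>\<^bsub>?G\<^esub> (c, d))"
    using T spherical_systems_third by (simp only: Teq)
  define \<beta> where "\<beta> = (\<lambda>(s, t)\<in>carrier ?G. ((s * a + t * c) mod ?q, (s * b + t * d) mod ?q))"
  have lin: "((s + u) mod ?q * e + (t + v) mod ?q * f) mod ?q
      = ((s * e + t * f) mod ?q + (u * e + v * f) mod ?q) mod ?q" for s t u v e f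
  proof -
    have "[(s + u) mod ?q * e + (t + v) mod ?q * f = (s + u) * e + (t + v) * f] (mod ?q)"
      by (intro cong_add cong_mult) simp_all
    also have "(s + u) * e + (t + v) * f = (s * e + t * f) + (u * e + v * f)"
      by (simp add: algebra_simps)
    finally show ?thesis by (simp add: cong_def mod_simps)
  qed
  have hom: "\<beta> \<in> hom ?G ?G"
  proof (rule homI)
    fix x y assume "x \<in> carrier ?G" "y \<in> carrier ?G"
    then show "\<beta> (x \<otimes>\<^bsub>?G\<^esub> y) = \<beta> x \<otimes>\<^bsub>?G\<^esub> \<beta> y"
      using p0 by (auto simp: \<beta>_def carrier_Zmod_square lin)
  qed (use p0 in \<open>auto simp: \<beta>_def carrier_Zmod_square\<close>)
  interpret b: group_hom ?G ?G \<beta> using hom by unfold_locales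
  have img: "subgroup (\<beta> ` carrier ?G) ?G" by (rule b.img_is_subgroup)
  have e: "(1, 0) \<in> carrier ?G" "(0, 1) \<in> carrier ?G" "(?q - 1, ?q - 1) \<in> carrier ?G"
    using p by (auto simp: carrier_Zmod_square)
  have \<beta>e: "\<beta> (1, 0) = (a, b)" "\<beta> (0, 1) = (c, d)"
    using e car p0 by (auto simp: \<beta>_def carrier_Zmod_square)
  have "standard_system p \<in> spherical_systems ?G" by (rule standard_system_spherical[OF p])
  then have "(?q - 1, ?q - 1) = inv\<^bsub>?G\<^esub> ((1, 0) \<otimes>\<^bsub>?G\<^esub> (0, 1))"
    using spherical_systems_third unfolding standard_system_def by blast
  then have \<beta>w: "\<beta> (?q - 1, ?q - 1) = w"
    unfolding w using e \<beta>e by (metis b.hom_inv b.hom_mult m_closed)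
  then have "{(a, b), (c, d), w} \<subseteq> \<beta> ` carrier ?G"
    using \<beta>e e by (metis empty_subsetI image_eqI insert_subset)
  then have "carrier ?G \<subseteq> \<beta> ` carrier ?G"
    using generate_subgroup_incl[OF _ img, of "{(a, b), (c, d), w}"] unfolding gen by blast
  then have surj: "\<beta> ` carrier ?G = carrier ?G"
    using b.hom_closed by blast
  then have "bij_betw \<beta> (carrier ?G) (carrier ?G)"
    using finite_surj_inj[OF finite_Zmod_square[OF p0]] by (simp add: bij_betw_def)
  then have "\<beta> \<in> auto ?G"
    using hom by (simp add: auto_def Bij_def \<beta>_def)
  moreover have "apply_triple \<beta> (standard_system p) = T"
    by (simp add: apply_triple_def standard_system_def Teq \<beta>e \<beta>w)
  ultimately show ?thesis by blast
qed

lemma auto_to_standard_system: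
  assumes p: "p \<ge> 2" and T: "T \<in> spherical_systems (Zmod_square p)"
  shows "\<exists>\<alpha>\<in>auto (Zmod_square p). apply_triple \<alpha> T = standard_system p"
proof -
  let ?G = "Zmod_square p"
  interpret comm_group ?G by (rule comm_group_Zmod_square)
  obtain \<beta> where \<beta>: "\<beta> \<in> auto ?G" "apply_triple \<beta> (standard_system p) = T"
    using auto_standard_system_to[OF assms] by blast
  define \<alpha> where "\<alpha> = restrict (inv_into (carrier ?G) \<beta>) (carrier ?G)"
  have bij: "\<beta> \<in> Bij (carrier ?G)" and inj: "inj_on \<beta> (carrier ?G)"
    using \<beta>(1) by (auto simp: auto_def Bij_def bij_betw_def)
  have "\<alpha> \<in> auto ?G"
    using subgroup.m_inv_closed[OF subgroup_auto \<beta>(1)] inv_BijGroup[OF bij] by (simp add: \<alpha>_def)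
  moreover have "\<alpha> (\<beta> x) = x" if "x \<in> carrier ?G" for x
    using that inj bij by (auto simp: \<alpha>_def dest: Bij_imp_funcset)
  then have "apply_triple \<alpha> T = standard_system p"
    using standard_system_spherical[OF p] unfolding \<beta>(2)[symmetric]
    by (auto simp: standard_system_def apply_triple_def spherical_systems_def)
  ultimately show ?thesis by blast
qed

lemma beauville_count_Zmod_square_le:
  assumes "p \<ge> 2"
  shows "beauville_count (Zmod_square p) m \<le> p ^ 4"
proof -
  interpret comm_group "Zmod_square p" by (rule comm_group_Zmod_square)
  have "beauville_count (Zmod_square p) m \<le> (order (Zmod_square p))\<^sup>2"
    using assms auto_to_standard_system[OF assms]
    by (intro beauville_count_le_if_transitive finite_Zmod_square) auto
  then show ?thesis using assms by (simp add: order_Zmod_square flip: power_mult)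
qed

section \<open>Many systems disjoint from the standard one\<close>

text \<open>
  Vectors spanning different lines have only \<open>0\<close> as a common multiple: taking the determinant of
  both sides of \<open>n (a, b) = m (c, d)\<close> with \<open>(c, d)\<close> gives \<open>n (a d - b c) = 0\<close> modulo \<open>p\<close>.
\<close>

lemma multiples_disjoint:
  fixes a b c d n m :: int and p :: nat
  assumes p: "prime p" and det: "\<not> int p dvd a * d - b * c"
    and eq: "(n * a mod p, n * b mod p) = (m * c mod p, m * d mod p)"
  shows "(n * a mod p, n * b mod p) = (0, 0)"
proof -
  have "[n * a = m * c] (mod int p)" "[n * b = m * d] (mod int p)"
    using eq by (simp_all add: cong_def)
  then have "[n * a * d - n * b * c = m * c * d - m * d * c] (mod int p)"
    by (intro cong_diff cong_scalar_right)
  then have "int p dvd n * (a * d - b * c)"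
    by (simp add: cong_0_iff algebra_simps)
  then have "int p dvd n"
    using det p by (simp add: prime_dvd_mult_iff)
  then show ?thesis by auto
qed

lemma not_dvd_if_between: "\<not> q dvd s" if "0 < s" "s < q" for q s :: int
  using that by (auto dest: zdvd_imp_le)

text \<open>
  The condition on the entries of \<open>T\<close> says that they avoid the three lines spanned by \<open>(0, 1)\<close>,
  \<open>(1, 0)\<close> and \<open>(1, 1)\<close>, on which the entries of the standard system lie.
\<close>

lemma disjoint_standard_system:
  assumes p: "prime p" and T: "T \<in> spherical_systems (Zmod_square p)"
    and off: "\<And>s t. (s, t) \<in> entries T \<Longrightarrow> s \<noteq> 0 \<and> t \<noteq> 0 \<and> s \<noteq> t"
  shows "disjoint_systems (Zmod_square p) (standard_system p) T"
proof -
  let ?G = "Zmod_square p" and ?q = "int p"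
  have p2: "p \<ge> 2" "p > 0" using p prime_ge_2_nat prime_gt_0_nat by auto
  obtain x y z where Teq: "T = (x, y, z)" by (metis surj_pair)
  have cT: "{x, y, z} \<subseteq> carrier ?G" using T by (auto simp: Teq spherical_systems_def)
  have cS: "{(1, 0), (0, 1), (?q - 1, ?q - 1)} \<subseteq> carrier ?G"
    using p2 by (auto simp: carrier_Zmod_square)
  have key: "(int n * a mod p, int n * b mod p) = (0, 0)"
    if ab: "(a, b) \<in> {(1, 0), (0, 1), (?q - 1, ?q - 1)}" and cd: "(c, d) \<in> {x, y, z}"
      and eq: "(int n * a mod p, int n * b mod p) = (int m * c mod p, int m * d mod p)"
    for a b c d n m
  proof (rule multiples_disjoint[OF p _ eq])
    have cd': "c \<noteq> 0" "d \<noteq> 0" "c \<noteq> d" "0 \<le> c" "c < ?q" "0 \<le> d" "d < ?q"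
      using cd off[of c d] cT p2 by (auto simp: Teq entries_def carrier_Zmod_square)
    have "\<not> ?q dvd c - d"
      using cd' not_dvd_if_between[of "c - d" ?q] not_dvd_if_between[of "d - c" ?q]
      by (metis dvd_diff_commute linorder_neqE_linordered_idom diff_gt_0_iff_gt
          le_less_trans diff_left_mono diff_zero)
    moreover have "(?q - 1) * d - (?q - 1) * c = (d - c) * ?q + (c - d)"
      by (simp add: algebra_simps)
    ultimately have "\<not> ?q dvd (?q - 1) * d - (?q - 1) * c"
      by (metis dvd_add_right_iff dvd_triv_right)
    moreover have "\<not> ?q dvd c" "\<not> ?q dvd d" using cd' not_dvd_if_between by auto
    ultimately show "\<not> ?q dvd a * d - b * c" using ab by auto
  qed
  have "Sigma_set ?G (standard_system p) \<inter> Sigma_set ?G T \<subseteq> {(0, 0)}"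
    unfolding Sigma_set_Zmod_square[OF standard_system_def cS] Sigma_set_Zmod_square[OF Teq cT]
    using key by blast
  moreover have "(0, 0) \<in> Sigma_set ?G (standard_system p) \<inter> Sigma_set ?G T"
    unfolding Sigma_set_Zmod_square[OF standard_system_def cS] Sigma_set_Zmod_square[OF Teq cT]
    by (cases x) (auto intro!: exI[of _ "0::nat"], blast+)
  ultimately show ?thesis by (auto simp: disjoint_systems_def)
qed

text \<open>
  The third entry is minus the sum of the first two. It needs no reduction modulo \<open>p\<close>
  when \<open>0 < a + c < p\<close> and \<open>0 < b + d < p\<close>.
\<close>

definition completed_system :: "nat \<Rightarrow> int \<Rightarrow> int \<Rightarrow> int \<Rightarrow> int \<Rightarrow> (int \<times> int) triple" where
  "completed_system p a b c d = ((a, b), (c, d), (int p - a - c, int p - b - d))"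

text \<open>
  The set of points \<open>(s, t)\<close> with \<open>0 < s < t\<close> is closed under addition, and no sum wraps around
  modulo \<open>p\<close>. Hence the first two entries lie strictly above the diagonal and the third strictly
  below it, all of them off the axes.
\<close>

lemma completed_system_ramification:
  assumes p: "prime p" and a: "0 < a" "a < b" and c: "0 < c" "c < d" and bd: "b + d < int p"
    and det: "\<not> int p dvd a * d - b * c"
  shows "(standard_system p, completed_system p a b c d)
    \<in> ramification_structures (Zmod_square p) (p, p, p) (p, p, p)"
proof -
  let ?G = "Zmod_square p" and ?q = "int p"
  have p2: "p \<ge> 2" "p > 0" using p prime_ge_2_nat prime_gt_0_nat by auto
  define w where "w = (?q - a - c, ?q - b - d)"
  have cT: "{(a, b), (c, d), w} \<subseteq> carrier ?G"
    using assms p2 by (auto simp: carrier_Zmod_square w_def)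
  have "coprime (a * d - b * c) ?q"
    using p det by (metis coprime_commute prime_imp_coprime prime_nat_int_transfer)
  then have "generate ?G {(a, b), (c, d), w} = carrier ?G"
    by (rule generate_Zmod_square[OF p2(2) cT])
  then have T: "completed_system p a b c d \<in> spherical_systems ?G"
    using cT by (simp add: spherical_systems_def completed_system_def w_def mod_simps)
  have S: "standard_system p \<in> spherical_systems ?G"
    by (rule standard_system_spherical[OF p2(1)])
  have ty: "system_type ?G R = (p, p, p)"
    if "R \<in> spherical_systems ?G" "(0, 0) \<notin> entries R" for R
    using that ord_Zmod_square[OF p]
    by (cases R) (fastforce simp: system_type_def spherical_systems_def entries_def)
  have "disjoint_systems ?G (standard_system p) (completed_system p a b c d)"
    by (rule disjoint_standard_system[OF p T])
      (use a c bd in \<open>auto simp: completed_system_def entries_def\<close>)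
  moreover have "system_type ?G (standard_system p) = (p, p, p)"
    by (rule ty[OF S]) (use p2 in \<open>auto simp: standard_system_def entries_def\<close>)
  moreover have "system_type ?G (completed_system p a b c d) = (p, p, p)"
    by (rule ty[OF T]) (use a c bd in \<open>auto simp: completed_system_def entries_def\<close>)
  ultimately show ?thesis using S T by (simp add: ramification_structures_def)
qed

text \<open>
  There are \<open>k ^ 4\<close> points \<open>(a, b, c, d)\<close> in the box, where \<open>a\<close> and \<open>c\<close> range over \<open>1, \<dots>, k\<close> and
  \<open>b\<close> and \<open>d\<close> over \<open>k + 1, \<dots>, 2 k\<close>. The determinant \<open>a d - b c\<close> is a nonconstant affine function
  of \<open>d\<close> modulo \<open>p\<close>, so it vanishes for at most one \<open>d\<close> for given \<open>a, b, c\<close>.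
\<close>

lemma card_slice_Zmod_square_ge:
  assumes p: "prime p" and k: "4 * k < p"
  shows "k ^ 4 - k ^ 3 \<le>
    card {T. (standard_system p, T) \<in> ramification_structures (Zmod_square p) (p, p, p) (p, p, p)}"
    (is "_ \<le> card ?V")
proof -
  define I J where "I = {1..int k}" and "J = {int k + 1..2 * int k}"
  define Q where "Q = I \<times> J \<times> I \<times> J"
  define bad where "bad = {(a, b, c, d) \<in> Q. int p dvd a * d - b * c}"
  define sys where "sys = (\<lambda>(a, b, c, d). completed_system p a b c d)"
  have card: "card Q = k ^ 4" "finite Q"
    by (simp_all add: Q_def I_def J_def card_cartesian_product power_def numeral_eq_Suc)
  have "inj_on (\<lambda>(a, b, c, d). (a, b, c)) bad"
  proof (rule inj_onI, clarsimp simp: bad_def)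
    fix a b c d e
    assume Q: "(a, b, c, d) \<in> Q" "(a, b, c, e) \<in> Q"
      and dvd: "int p dvd a * d - b * c" "int p dvd a * e - b * c"
    have "int p dvd a * (d - e)"
      using dvd_diff[OF dvd] by (simp add: algebra_simps)
    moreover have "\<not> int p dvd a"
      using Q k by (intro not_dvd_if_between) (auto simp: Q_def I_def)
    ultimately have "int p dvd d - e" using p by (simp add: prime_dvd_mult_iff)
    then have "\<not> 0 < d - e" "\<not> 0 < e - d"
      using Q k not_dvd_if_between[of "d - e" "int p"] not_dvd_if_between[of "e - d" "int p"]
      by (auto simp: Q_def J_def dvd_diff_commute)
    then show "d = e" by simp
  qed
  moreover have "(\<lambda>(a, b, c, d). (a, b, c)) ` bad \<subseteq> I \<times> J \<times> I"
    by (auto simp: bad_def Q_def)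
  ultimately have "card bad \<le> card (I \<times> J \<times> I)"
    by (rule card_inj_on_le) (simp add: I_def J_def)
  also have "\<dots> = k ^ 3"
    by (simp add: I_def J_def card_cartesian_product power3_eq_cube)
  finally have "k ^ 4 - k ^ 3 \<le> card Q - card bad" using card by simp
  also have "\<dots> \<le> card (Q - bad)"
    by (rule diff_card_le_card_Diff) (use card in \<open>auto simp: bad_def intro: finite_subset[of _ Q]\<close>)
  also have "\<dots> \<le> card ?V"
  proof (rule card_inj_on_le)
    show "inj_on sys (Q - bad)"
      by (rule inj_onI) (auto simp: sys_def completed_system_def)
    show "sys ` (Q - bad) \<subseteq> ?V"
      using k
      by (auto simp: sys_def bad_def Q_def I_def J_def intro!: completed_system_ramification[OF p])
    interpret comm_group "Zmod_square p" by (rule comm_group_Zmod_square)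
    have "finite (ramification_structures (Zmod_square p) (p, p, p) (p, p, p))"
      using p prime_gt_0_nat by (intro finite_ramification_structures finite_Zmod_square) auto
    then have "finite (snd ` ramification_structures (Zmod_square p) (p, p, p) (p, p, p))" by simp
    then show "finite ?V" by (rule rev_finite_subset) force
  qed
  finally show ?thesis .
qed

section \<open>Comparison with \<open>\<chi>\<close>\<close>

lemma surface_chi_Zmod_square:
  assumes "p > 0" "x \<in> ramification_structures (Zmod_square p) (p, p, p) (p, p, p)"
  shows "surface_chi (Zmod_square p) x = (real p - 3)\<^sup>2 / 4"
  using assms
  by (cases x) (simp add: ramification_structures_def surface_chi_def orbifold_factor_def
      order_Zmod_square field_simps power2_eq_square)

theorem corollary1p11:
  fixes S :: "nat \<Rightarrow> (int \<times> int) triple \<times> (int \<times> int) triple"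
  assumes "\<And>p. prime p \<Longrightarrow> p \<ge> 5 \<Longrightarrow>
             S p \<in> ramification_structures (Zmod_square p) (p, p, p) (p, p, p)"
  shows "(\<lambda>p. real (beauville_count (Zmod_square p) p))
           \<in> \<Theta>[inf at_top (principal {p. prime p})](\<lambda>p. (surface_chi (Zmod_square p) (S p))\<^sup>2)"
proof -
  \<comment> \<open>With \<open>k = p div 4\<close> and \<open>h\<close> the number of orbits, \<open>(p - 3) ^ 4 / 16 \<le> (4 k) ^ 4 / 16 = 16 k ^ 4\<close>
    and \<open>k ^ 4 \<le> 2 (k ^ 4 - k ^ 3) \<le> 2 \<sqdot> 1458 h\<close>. The bound \<open>k ^ 4 \<le> 2 (k ^ 4 - k ^ 3)\<close> needs
    \<open>k \<ge> 2\<close>, that is \<open>p \<ge> 8\<close>.\<close>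
  define c :: real where "c = 32 * 1458"
  have bounds: "(surface_chi (Zmod_square p) (S p))\<^sup>2 \<le> c * beauville_count (Zmod_square p) p \<and>
      beauville_count (Zmod_square p) p \<le> 625 * (surface_chi (Zmod_square p) (S p))\<^sup>2"
    if p: "prime p" "p \<ge> 8" for p
  proof
    define h where "h = beauville_count (Zmod_square p) p"
    define k where "k = p div 4"
    have chi: "(surface_chi (Zmod_square p) (S p))\<^sup>2 = (real p - 3) ^ 4 / 16"
      using surface_chi_Zmod_square[of p "S p"] assms[of p] p
      by (simp only: power_divide flip: power_mult) simp
    have "\<not> 4 dvd p"
      using p prime_nat_iff[of p] by auto
    then have k: "4 * k < p" "p \<le> 4 * k + 3" "k \<ge> 2"
      using p(2) unfolding k_def by presburger+
    interpret comm_group "Zmod_square p" by (rule comm_group_Zmod_square)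
    have "k ^ 4 - k ^ 3 \<le> 1458 * h"
      using card_slice_Zmod_square_ge[OF p(1) k(1)]
        card_slice_le_beauville_count[OF finite_Zmod_square, of "standard_system p" p] p
      unfolding h_def by linarith
    moreover have "2 * k ^ 3 \<le> k * k ^ 3" by (rule mult_right_mono[OF k(3)]) simp
    moreover have "k * k ^ 3 = k ^ 4" by (simp flip: power_Suc)
    ultimately have "k ^ 4 \<le> 2916 * h" by linarith
    then have "real k ^ 4 \<le> 2916 * real h" by (metis of_nat_le_iff of_nat_mult of_nat_numeral of_nat_power)
    moreover have "(real p - 3) ^ 4 \<le> (4 * real k) ^ 4"
      using k(2) p(2) by (intro power_mono) linarith+
    ultimately have "(real p - 3) ^ 4 / 16 \<le> c * real h"
      by (simp add: power_mult_distrib c_def)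
    then show "(surface_chi (Zmod_square p) (S p))\<^sup>2 \<le> c * beauville_count (Zmod_square p) p"
      by (simp add: chi h_def)
    have "h \<le> p ^ 4" unfolding h_def using p(2) by (intro beauville_count_Zmod_square_le) simp
    then have "real h \<le> real p ^ 4" by (metis of_nat_le_iff of_nat_power)
    \<comment> \<open>\<open>p \<le> 5/2 (p - 3)\<close> amounts to \<open>p \<ge> 5\<close>.\<close>
    also have "\<dots> \<le> (5 / 2 * (real p - 3)) ^ 4"
      using p(2) by (intro power_mono) auto
    also have "\<dots> = 625 * ((real p - 3) ^ 4 / 16)" 
      unfolding power_mult_distrib by (simp add: power_divide)
    finally show "beauville_count (Zmod_square p) p \<le> 625 * (surface_chi (Zmod_square p) (S p))\<^sup>2"
      by (simp add: chi h_def)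
  qed
  have ev: "eventually (\<lambda>p. prime p \<and> p \<ge> 8) (inf at_top (principal {p::nat. prime p}))"
    by (auto simp: eventually_inf_principal intro: eventually_mono[OF eventually_ge_at_top[of 8]])
  show ?thesis
  proof (rule bigthetaI)
    show "(\<lambda>p. real (beauville_count (Zmod_square p) p))
        \<in> O[inf at_top (principal {p. prime p})](\<lambda>p. (surface_chi (Zmod_square p) (S p))\<^sup>2)"
      by (rule bigoI[of _ 625]) (use ev in \<open>eventually_elim, use bounds in auto\<close>)
    show "(\<lambda>p. real (beauville_count (Zmod_square p) p))
        \<in> \<Omega>[inf at_top (principal {p. prime p})](\<lambda>p. (surface_chi (Zmod_square p) (S p))\<^sup>2)"
      unfolding bigomega_iff_bigo
      by (rule bigoI[of _ c]) (use ev in \<open>eventually_elim, use bounds in auto\<close>)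
  qed
qed

end
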